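(* Let $d,M\in\mathbb N_+$, let $(X,\rho)=([0,1]^d,\|\cdot\|_1)$, let $G\in\mathbb R^{M\times M}$ be fixed, and let $\theta=((a_m,b_m,c_m))_{m=1}^M\in(\mathbb R\times X\times[0,\infty))^M$. For every inverse-temperature parameter $\lambda>0$ and every prescribed number of attention heads $H\in\mathbb N_+$, there exists an $H$-head ReLU-transformer $\hat T:\mathbb R^d\to\mathbb R$ of depth $\mathcal O(\log M)$, width $\mathcal O(M+H)$, and with $\mathcal O(M)$ nonzero parameters such that $$\hat T(x)=\hat f_\theta(x\mid G)\qquad\text{for every }x\in X,$$ where, with $a=(a_1,\dots,a_M)$ viewed as a row vector, $$\hat f_\theta(x\mid G):=\tfrac12\Big(\min_{1\le m\le M}\big((aG)_m+c_m\|x-b_m\|_1\big)+\max_{1\le m\le M}\big((aG)_m-c_m\|x-b_m\|_1\big)\Big).$$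
   Context: Convention: "$\mathcal O(g)$" means at most $K_d\max\{1,g\}$ for a constant $K_d$ depending only on $d$. Attention: for $\lambda>0$, $Q,K\in\mathbb R^{d_{\rm key}\times d_{\rm in}}$, $V\in\mathbb R^{d_{\rm out}\times d_{\rm in}}$ and an input $\mathbf X\in\mathbb R^{T\times d_{\rm in}}$ with rows (tokens) $[\mathbf X]_1,\dots,[\mathbf X]_T$ viewed as column vectors, $$[\operatorname{Attn}(\mathbf X\mid Q,K,V,\lambda)]_n:=\sum_{m=1}^T\frac{e^{\lambda\langle Q[\mathbf X]_n,K[\mathbf X]_m\rangle/\sqrt{d_{\rm key}}}}{\sum_{l=1}^Te^{\lambda\langle Q[\mathbf X]_n,K[\mathbf X]_l\rangle/\sqrt{d_{\rm key}}}}\,V[\mathbf X]_m .$$ ReLU-transformer of depth $L$: with layer dimensions $d_0,\dots,d_L$, set $\mathbf X^{(0)}=\mathbf X\in\mathbb R^{T\times d_0}$ and, for $j=0,\dots,L-2$, let $\mathbf Z^{(j)}\in\mathbb R^{T\times d_{j+1}}$ be the column-wise concatenation over heads $h=1,\dots,H_j$ of $\operatorname{Attn}(\mathbf X^{(j)}\mid Q_h^{(j)},K_h^{(j)},V_h^{(j)},\lambda)$ (head $h$ having some key dimension and value dimension $d^{(j)}_{{\rm value},h}\in\mathbb N_+$, with $\sum_hd^{(j)}_{{\rm value},h}=d_{j+1}$), and $[\mathbf X^{(j+1)}]_n=\operatorname{ReLU}([\mathbf Z^{(j)}]_n+b^{(j)})$ componentwise for each row $n$; the output is obtained by applying an affine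 map $y\mapsto A^{(L-1)}y+b^{(L-1)}$ to each row of $\mathbf X^{(L-1)}$. It is $H$-head if $H_j=H$ for every $j=0,\dots,L-2$. Its width is the maximal layer dimension, and its nonzero parameters are the nonzero entries of all the $Q,K,V,A,b$. A map on $\mathbb R^d$ is regarded as acting on one-token inputs ($T=1$, $\mathbb R^d\cong\mathbb R^{1\times d}$). *)

theory Defs
  imports Complex_Main "Jordan_Normal_Form.Matrix"
begin

text \<open>
  All indices start at 0: tokens are the rows \<open>row X 0, \<dots>, row X (T - 1)\<close> of an input matrix \<open>X\<close>
  with \<open>T\<close> rows, and coordinates of vectors are \<open>v $ 0, \<dots>, v $ (dim_vec v - 1)\<close>.
\<close>

subsection \<open>Attention\<close>

text \<open>\<open>lam\<close> is the inverse temperature \<open>\<lambda>\<close>.\<close>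

definition attn_logit ::
  "real \<Rightarrow> real mat \<Rightarrow> real mat \<Rightarrow> real mat \<Rightarrow> nat \<Rightarrow> nat \<Rightarrow> real" where
  "attn_logit lam Q K X n m = lam * ((Q *\<^sub>v row X n) \<bullet> (K *\<^sub>v row X m)) / sqrt (real (dim_row Q))"

definition attn :: "real \<Rightarrow> real mat \<Rightarrow> real mat \<Rightarrow> real mat \<Rightarrow> real mat \<Rightarrow> real mat" where
  "attn lam Q K V X = mat (dim_row X) (dim_row V) (\<lambda>(n, i).
     \<Sum>m<dim_row X. exp (attn_logit lam Q K X n m) / (\<Sum>l<dim_row X. exp (attn_logit lam Q K X n l))
                      * (V *\<^sub>v row X m) $ i)"


subsection \<open>ReLU-transformers\<close>

record attn_head =
  query :: "real mat"
  key :: "real mat"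
  val :: "real mat"

record attn_block =
  heads :: "attn_head list"
  bias :: "real vec"

text \<open>
  \<open>layer_dims\<close> is the list \<open>[d\<^sub>0, \<dots>, d\<^sub>L]\<close>, \<open>blocks\<close> lists the attention blocks
  \<open>j = 0, \<dots>, L - 2\<close>, and \<open>out_weight\<close>, \<open>out_bias\<close> are \<open>A\<close> and \<open>b\<close> of the final affine map.
\<close>

record transformer =
  layer_dims :: "nat list"
  blocks :: "attn_block list"
  out_weight :: "real mat"
  out_bias :: "real vec"

definition wf_head :: "nat \<Rightarrow> attn_head \<Rightarrow> bool" where
  "wf_head d_in h \<longleftrightarrow>
     (\<exists>d_key>0. query h \<in> carrier_mat d_key d_in \<and> key h \<in> carrier_mat d_key d_in) \<and>
     (\<exists>d_value>0. val h \<in> carrier_mat d_value d_in)"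

definition wf_block :: "nat \<Rightarrow> nat \<Rightarrow> attn_block \<Rightarrow> bool" where
  "wf_block d_in d_out B \<longleftrightarrow>
     (\<forall>h\<in>set (heads B). wf_head d_in h) \<and>
     (\<Sum>h\<leftarrow>heads B. dim_row (val h)) = d_out \<and>
     bias B \<in> carrier_vec d_out"

definition depth :: "transformer \<Rightarrow> nat" where
  "depth N = length (layer_dims N) - 1"

definition wf_transformer :: "transformer \<Rightarrow> bool" where
  "wf_transformer N \<longleftrightarrow>
     depth N \<ge> 1 \<and>
     (\<forall>n\<in>set (layer_dims N). n > 0) \<and>
     length (blocks N) = depth N - 1 \<and>
     (\<forall>j<depth N - 1. wf_block (layer_dims N ! j) (layer_dims N ! (j + 1)) (blocks N ! j)) \<and>
     out_weight N \<in> carrier_mat (layer_dims N ! depth N) (layer_dims N ! (depth N - 1)) \<and>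
     out_bias N \<in> carrier_vec (layer_dims N ! depth N)"

definition transformer_between :: "nat \<Rightarrow> nat \<Rightarrow> transformer \<Rightarrow> bool" where
  "transformer_between d_in d_out N \<longleftrightarrow>
     wf_transformer N \<and> layer_dims N ! 0 = d_in \<and> layer_dims N ! depth N = d_out"

definition multi_head :: "real \<Rightarrow> attn_head list \<Rightarrow> real mat \<Rightarrow> real mat" where
  "multi_head lam hs X =
     mat_of_cols (dim_row X) (concat (map (\<lambda>h. cols (attn lam (query h) (key h) (val h) X)) hs))"

definition relu :: "real vec \<Rightarrow> real vec" where
  "relu = map_vec (max 0)"

definition block_map :: "real \<Rightarrow> attn_block \<Rightarrow> real mat \<Rightarrow> real mat" where
  "block_map lam B X =
     mat_of_rows (dim_vec (bias B)) (map (\<lambda>z. relu (z + bias B)) (rows (multi_head lam (heads B) X)))"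

definition transformer_map :: "real \<Rightarrow> transformer \<Rightarrow> real mat \<Rightarrow> real mat" where
  "transformer_map lam N X =
     mat_of_rows (dim_row (out_weight N))
       (map (\<lambda>y. out_weight N *\<^sub>v y + out_bias N) (rows (fold (block_map lam) (blocks N) X)))"

text \<open>A transformer with scalar output, as a function of a single token.\<close>

definition transformer_fun :: "real \<Rightarrow> transformer \<Rightarrow> real vec \<Rightarrow> real" where
  "transformer_fun lam N x = transformer_map lam N (mat_of_row x) $$ (0, 0)"

definition n_headed :: "nat \<Rightarrow> transformer \<Rightarrow> bool" where
  "n_headed H N \<longleftrightarrow> (\<forall>B\<in>set (blocks N). length (heads B) = H)"

definition width :: "transformer \<Rightarrow> nat" where
  "width N = Max (set (layer_dims N))"

definition nnz_mat :: "real mat \<Rightarrow> nat" where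
  "nnz_mat A = card {(i, j). i < dim_row A \<and> j < dim_col A \<and> A $$ (i, j) \<noteq> 0}"

definition nnz_vec :: "real vec \<Rightarrow> nat" where
  "nnz_vec v = card {i. i < dim_vec v \<and> v $ i \<noteq> 0}"

definition nonzero_params :: "transformer \<Rightarrow> nat" where
  "nonzero_params N =
     (\<Sum>B\<leftarrow>blocks N.
        (\<Sum>h\<leftarrow>heads B. nnz_mat (query h) + nnz_mat (key h) + nnz_mat (val h)) + nnz_vec (bias B))
     + nnz_mat (out_weight N) + nnz_vec (out_bias N)"


subsection \<open>The function \<open>f\<^sub>\<theta>\<close> on the unit cube\<close>

definition unit_cube :: "nat \<Rightarrow> real vec set" where
  "unit_cube d = {x \<in> carrier_vec d. \<forall>i<d. 0 \<le> x $ i \<and> x $ i \<le> 1}"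

definition l1_norm :: "real vec \<Rightarrow> real" where
  "l1_norm v = (\<Sum>i<dim_vec v. \<bar>v $ i\<bar>)"

text \<open>\<open>\<theta> m\<close> is the triple \<open>(a\<^sub>m, b\<^sub>m, c\<^sub>m)\<close> for \<open>m < M\<close>; values at \<open>m \<ge> M\<close> are irrelevant.\<close>

definition f_hat :: "nat \<Rightarrow> (nat \<Rightarrow> real \<times> real vec \<times> real) \<Rightarrow> real mat \<Rightarrow> real vec \<Rightarrow> real" where
  "f_hat M \<theta> G x =
    (let aG = mat_of_row (vec M (\<lambda>m. fst (\<theta> m))) * G;
         b = (\<lambda>m. fst (snd (\<theta> m)));
         c = (\<lambda>m. snd (snd (\<theta> m)))
     in 1 / 2 * ((MIN m\<in>{..<M}. aG $$ (0, m) + c m * l1_norm (x - b m)) +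
                 (MAX m\<in>{..<M}. aG $$ (0, m) - c m * l1_norm (x - b m))))"

end

theory Submission
  imports Defs
begin

text \<open>
  On a single token the softmax weight is \<open>1\<close>, so an attention block is an ordinary ReLU layer
  \<open>x \<mapsto> max 0 (W x + b)\<close>. As the minimum is the negative of a maximum, \<open>f_hat\<close> is half the
  difference of the maxima of \<open>(aG)\<^sub>m - c\<^sub>m \<parallel>x - b\<^sub>m\<parallel>\<^sub>1\<close> and of
  \<open>- (aG)\<^sub>m - c\<^sub>m \<parallel>x - b\<^sub>m\<parallel>\<^sub>1\<close>. Two layers compute all these numbers, shifted to be
  nonnegative, and a binary tournament of logarithmic depth computes both maxima.
\<close>

section \<open>Attention on a single token\<close>

lemma cols_mat_of_row: "cols (mat_of_row v) = map (\<lambda>a. vec 1 (\<lambda>_. a)) (list_of_vec v)"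
  by (rule nth_equalityI) (auto simp: mat_of_row_def list_of_vec_index)

lemma mat_of_cols_singletons:
  "mat_of_cols 1 (map (\<lambda>a. vec 1 (\<lambda>_. a)) as) = mat_of_row (vec_of_list as)"
  by (rule eq_matI) (auto simp: mat_of_cols_index mat_of_row_def vec_of_list_index)

lemma attn_single_token:
  "attn lam Q K V (mat_of_row x) = mat_of_row (V *\<^sub>v x)"
proof -
  have "row (mat_of_row x) 0 = x" by (rule eq_vecI) (auto simp: mat_of_row_def)
  then show ?thesis by (intro eq_matI) (auto simp: attn_def)
qed

text \<open>With one row every column is a singleton, so joining head outputs column-wise just
  concatenates the entries of the vectors \<open>val h *\<^sub>v x\<close>.\<close>

lemma multi_head_single_token:
  "multi_head lam hs (mat_of_row x) =
     mat_of_row (vec_of_list (concat (map (\<lambda>h. list_of_vec (val h *\<^sub>v x)) hs)))"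
proof -
  have "concat (map (\<lambda>h. cols (attn lam (query h) (key h) (val h) (mat_of_row x))) hs) =
      map (\<lambda>a. vec 1 (\<lambda>_. a)) (concat (map (\<lambda>h. list_of_vec (val h *\<^sub>v x)) hs))"
    by (induction hs) (auto simp: attn_single_token cols_mat_of_row)
  then show ?thesis
    by (simp add: multi_head_def mat_of_cols_singletons[symmetric])
qed

section \<open>ReLU layers with a prescribed number of heads\<close>

text \<open>Zero query and key matrices add no nonzero parameters; they get key dimension 1 because
  a key dimension must be positive.\<close>

definition linear_head :: "real mat \<Rightarrow> attn_head" where
  "linear_head W = \<lparr>query = 0\<^sub>m 1 (dim_col W), key = 0\<^sub>m 1 (dim_col W), val = W\<rparr>"

lemma val_linear_head [simp]: "val (linear_head W) = W"
  by (simp add: linear_head_def)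

lemma wf_linear_head:
  assumes "W \<in> carrier_mat r n" "r > 0"
  shows "wf_head n (linear_head W)"
  using assms unfolding wf_head_def linear_head_def by auto

text \<open>Since every head contributes at least one column, the prescribed number of heads is reached
  with zero heads; they append \<open>H - 1\<close> idle coordinates to the layer.\<close>

definition affine_block :: "nat \<Rightarrow> real mat \<Rightarrow> real vec \<Rightarrow> attn_block" where
  "affine_block H W b =
     \<lparr>heads = linear_head W # replicate (H - 1) (linear_head (0\<^sub>m 1 (dim_col W))),
      bias = b @\<^sub>v 0\<^sub>v (H - 1)\<rparr>"

lemma wf_affine_block:
  assumes "W \<in> carrier_mat r n" "b \<in> carrier_vec r" "r > 0"
  shows "wf_block n (r + (H - 1)) (affine_block H W b)"
  unfolding wf_block_def
proof (intro conjI ballI)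
  fix h assume "h \<in> set (heads (affine_block H W b))"
  then consider "h = linear_head W" | "h = linear_head (0\<^sub>m 1 n)"
    using assms(1) by (auto simp: affine_block_def split: if_splits)
  then show "wf_head n h"
    using wf_linear_head[OF assms(1,3)] wf_linear_head[of "0\<^sub>m 1 n" 1 n] by cases auto
qed (use assms in \<open>auto simp: affine_block_def sum_list_replicate\<close>)

lemma list_of_vec_zero_mat_mult:
  assumes "x \<in> carrier_vec n"
  shows "list_of_vec (0\<^sub>m 1 n *\<^sub>v x) = [0 :: real]"
proof -
  have "0\<^sub>m 1 n *\<^sub>v x = 0\<^sub>v 1" using assms by auto
  then show ?thesis
    by (simp add: zero_vec_def list_of_vec_vec)
qed

text \<open>The idle heads output 0 and meet a zero bias, and ReLU fixes 0, so the padding stays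
  exactly zero and cannot disturb the next layer.\<close>

lemma block_map_affine_block:
  assumes "W \<in> carrier_mat r n" "b \<in> carrier_vec r" "x \<in> carrier_vec n"
  shows "block_map lam (affine_block H W b) (mat_of_row x) =
    mat_of_row (relu (W *\<^sub>v x + b) @\<^sub>v 0\<^sub>v (H - 1))"
proof -
  have [simp]: "dim_row W = r" "dim_col W = n" "dim_vec b = r" using assms by auto
  have [simp]: "concat (replicate k [0]) = replicate k (0::real)" for k
    by (induction k) auto
  have "vec_of_list (list_of_vec (W *\<^sub>v x) @ replicate (H - 1) 0) = (W *\<^sub>v x) @\<^sub>v 0\<^sub>v (H - 1)"
    by (rule eq_vecI) (auto simp: vec_of_list_index nth_append list_of_vec_index)
  then have mh: "multi_head lam (heads (affine_block H W b)) (mat_of_row x) =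
      mat_of_row ((W *\<^sub>v x) @\<^sub>v 0\<^sub>v (H - 1))"
    using assms
    by (simp add: multi_head_single_token affine_block_def list_of_vec_zero_mat_mult
        del: One_nat_def)
  have "relu (((W *\<^sub>v x) @\<^sub>v 0\<^sub>v (H - 1)) + (b @\<^sub>v 0\<^sub>v (H - 1))) = relu (W *\<^sub>v x + b) @\<^sub>v 0\<^sub>v (H - 1)"
    by (rule eq_vecI) (auto simp: relu_def)
  then show ?thesis
    unfolding block_map_def mh
    by (simp add: affine_block_def mat_of_rows_def mat_of_row_def relu_def)
       (auto intro!: eq_matI)
qed

lemma layer_output_carrier:
  assumes "W \<in> carrier_mat r n" "b \<in> carrier_vec r"
  shows "relu (W *\<^sub>v x + b) @\<^sub>v 0\<^sub>v k \<in> carrier_vec (r + k)"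
  using assms by (intro append_carrier_vec carrier_vecI) (auto simp: relu_def)

section \<open>Counting nonzero entries\<close>

lemma nnz_mat_zero [simp]: "nnz_mat (0\<^sub>m r n) = 0"
  by (auto simp: nnz_mat_def card_eq_0_iff)

lemma nnz_vec_zero [simp]: "nnz_vec (0\<^sub>v n) = 0"
  by (simp add: nnz_vec_def cong: conj_cong)

lemma nnz_vec_append_zero: "nnz_vec (b @\<^sub>v 0\<^sub>v k) = nnz_vec b"
  unfolding nnz_vec_def by (rule arg_cong[where f = card]) (auto split: if_splits)

lemma nnz_vec_le: "nnz_vec b \<le> dim_vec b"
proof -
  have "nnz_vec b \<le> card {..<dim_vec b}"
    unfolding nnz_vec_def by (rule card_mono) auto
  then show ?thesis by simp
qed

text \<open>Here \<open>S i\<close> covers the support of row \<open>i\<close>. Counting by rows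
  keeps the number of columns, and with it the idle coordinates, out of the bound, so
  \<open>H\<close> never enters the parameter count.\<close>

lemma nnz_mat_le:
  assumes "A \<in> carrier_mat r n"
    and "\<And>i j. i < r \<Longrightarrow> j < n \<Longrightarrow> A $$ (i, j) \<noteq> 0 \<Longrightarrow> j \<in> S i"
    and "\<And>i. i < r \<Longrightarrow> finite (S i) \<and> card (S i) \<le> k"
  shows "nnz_mat A \<le> r * k"
proof -
  have "nnz_mat A \<le> card (SIGMA i:{..<r}. S i)"
    unfolding nnz_mat_def using assms by (intro card_mono) auto
  also have "\<dots> = (\<Sum>i<r. card (S i))"
    using assms by (subst card_SigmaI) auto
  also have "\<dots> \<le> r * k"
    using assms(3) sum_bounded_above[of "{..<r}" "\<lambda>i. card (S i)" k] by simp
  finally show ?thesis .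
qed

section \<open>Stacking layers\<close>

text \<open>\<open>L\<close> is the exact depth, while \<open>w\<close> and \<open>p\<close> are
  upper bounds. Inputs are restricted to \<open>S\<close> because values pass through a ReLU
  unchanged only where they are nonnegative.\<close>

definition realizable ::
  "real \<Rightarrow> nat \<Rightarrow> nat \<Rightarrow> nat \<Rightarrow> nat \<Rightarrow> nat \<Rightarrow> real vec set \<Rightarrow> (real vec \<Rightarrow> real) \<Rightarrow> bool" where
  "realizable lam H n L w p S f \<longleftrightarrow> (\<exists>N. transformer_between n 1 N \<and> n_headed H N \<and>
     depth N = L \<and> width N \<le> w \<and> nonzero_params N \<le> p \<and> (\<forall>x\<in>S. transformer_fun lam N x = f x))"

lemma realizable_mono:
  assumes "realizable lam H n L w p S f" "w \<le> w'" "p \<le> p'"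
  shows "realizable lam H n L w' p' S f"
proof -
  obtain N where "transformer_between n 1 N" "n_headed H N" "depth N = L" "width N \<le> w"
    "nonzero_params N \<le> p" "\<forall>x\<in>S. transformer_fun lam N x = f x"
    using assms(1) unfolding realizable_def by blast
  then show ?thesis
    using assms(2,3) unfolding realizable_def by (intro exI[of _ N]) auto
qed

lemma realizable_linear:
  assumes "n > 0" "A \<in> carrier_mat 1 n" "S \<subseteq> carrier_vec n"
    and "\<And>x. x \<in> S \<Longrightarrow> (A *\<^sub>v x) $ 0 = f x"
  shows "realizable lam H n 1 n (nnz_mat A) S f"
proof -
  define N where "N = \<lparr>layer_dims = [n, 1], blocks = [], out_weight = A, out_bias = 0\<^sub>v 1\<rparr>"
  have "transformer_between n 1 N" "n_headed H N" "depth N = 1" "width N \<le> n"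
    "nonzero_params N \<le> nnz_mat A"
    using assms by (auto simp: transformer_between_def wf_transformer_def N_def depth_def
        n_headed_def width_def nonzero_params_def)
  moreover have "transformer_fun lam N x = f x" if "x \<in> S" for x
    using assms that by (auto simp: transformer_fun_def transformer_map_def N_def mat_of_rows_def)
  ultimately show ?thesis unfolding realizable_def by blast
qed

text \<open>Networks are built from the output towards the input. The tail receives the padded
  output of the new layer, hence its input dimension \<open>r + (H - 1)\<close>, which
  \<open>w\<close> already accounts for; only \<open>n\<close> is new in the width.\<close>

lemma realizable_prepend:
  assumes N: "realizable lam H (r + (H - 1)) L w p S f"
    and H: "H > 0" and n: "n > 0" and r: "r > 0"
    and W: "W \<in> carrier_mat r n" and b: "b \<in> carrier_vec r"
    and T: "T \<subseteq> carrier_vec n"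
    and S: "\<And>x. x \<in> T \<Longrightarrow> relu (W *\<^sub>v x + b) @\<^sub>v 0\<^sub>v (H - 1) \<in> S"
    and f: "\<And>x. x \<in> T \<Longrightarrow> f (relu (W *\<^sub>v x + b) @\<^sub>v 0\<^sub>v (H - 1)) = g x"
  shows "realizable lam H n (Suc L) (max n w) (nnz_mat W + nnz_vec b + p) T g"
proof -
  from N obtain N where N: "transformer_between (r + (H - 1)) 1 N" "n_headed H N"
     "depth N = L" "width N \<le> w" "nonzero_params N \<le> p" "\<forall>x\<in>S. transformer_fun lam N x = f x"
    unfolding realizable_def by blast
  define B where "B = affine_block H W b"
  define N' where "N' = N\<lparr>layer_dims := n # layer_dims N, blocks := B # blocks N\<rparr>"
  have wfN: "wf_transformer N" using N by (simp add: transformer_between_def)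
  then have len: "length (layer_dims N) = Suc (depth N)" and d1: "depth N \<ge> 1"
    unfolding wf_transformer_def depth_def by auto
  have dN': "depth N' = Suc (depth N)" unfolding depth_def[of N'] by (simp add: N'_def len)
  have wfB: "wf_block n (r + (H - 1)) B"
    unfolding B_def by (rule wf_affine_block[OF W b r])
  have hd: "layer_dims N ! 0 = r + (H - 1)" and lst: "layer_dims N ! depth N = 1"
    using N by (auto simp: transformer_between_def)
  have "wf_transformer N'"
    unfolding wf_transformer_def
  proof (intro conjI allI impI)
    fix j assume j: "j < depth N' - 1"
    show "wf_block (layer_dims N' ! j) (layer_dims N' ! (j + 1)) (blocks N' ! j)"
    proof (cases j)
      case 0
      then show ?thesis using wfB by (simp add: N'_def hd)
    next
      case (Suc i)
      then show ?thesis using wfN j[unfolded dN'] by (auto simp: N'_def wf_transformer_def)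
    qed
  next
    show "out_weight N' \<in> carrier_mat (layer_dims N' ! depth N') (layer_dims N' ! (depth N' - 1))"
      using wfN d1 unfolding dN' by (auto simp: N'_def wf_transformer_def nth_Cons')
  qed (use wfN n d1 in \<open>unfold dN', auto simp: N'_def wf_transformer_def\<close>)
  then have "transformer_between n 1 N'"
    using lst unfolding transformer_between_def dN' by (auto simp: N'_def)
  moreover have "n_headed H N'"
    using N H by (auto simp: n_headed_def N'_def B_def affine_block_def)
  moreover have "depth N' = Suc L" using dN' N by simp
  moreover have "width N' \<le> max n w"
  proof -
    have "layer_dims N \<noteq> []" using len by auto
    then show ?thesis using N(4) by (auto simp: width_def N'_def)
  qed
  moreover have "nonzero_params N' \<le> nnz_mat W + nnz_vec b + p"
    using N by (simp add: nonzero_params_def N'_def B_def affine_block_def linear_head_def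
        sum_list_replicate nnz_vec_append_zero)
  moreover have "transformer_fun lam N' x = g x" if x: "x \<in> T" for x
  proof -
    have "transformer_fun lam N' x =
        transformer_fun lam N (relu (W *\<^sub>v x + b) @\<^sub>v 0\<^sub>v (H - 1))"
      using block_map_affine_block[OF W b, of x] x T
      by (auto simp: transformer_fun_def transformer_map_def N'_def B_def)
    then show ?thesis using N S f x by auto
  qed
  ultimately show ?thesis unfolding realizable_def by blast
qed

section \<open>Maxima by a binary tournament\<close>

lemma mult_mat_vec_support:
  assumes "A \<in> carrier_mat r n" "y \<in> carrier_vec n" "i < r" "S \<subseteq> {..<n}"
    and "\<And>j. j < n \<Longrightarrow> j \<notin> S \<Longrightarrow> A $$ (i, j) = 0"
  shows "(A *\<^sub>v y) $ i = (\<Sum>j\<in>S. A $$ (i, j) * y $ j)"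
proof -
  have "(A *\<^sub>v y) $ i = (\<Sum>j<n. A $$ (i, j) * y $ j)"
    using assms by (auto simp: scalar_prod_def atLeast0LessThan intro!: sum.cong)
  also have "\<dots> = (\<Sum>j\<in>S. A $$ (i, j) * y $ j)"
    using assms by (intro sum.mono_neutral_right) auto
  finally show ?thesis .
qed

text \<open>Every index \<open>i\<close> below \<open>2 * n\<close> is \<open>i mod n\<close> or
  \<open>i mod n + n\<close>, so one round of pairwise maxima loses no entry.\<close>

lemma Max_halves:
  fixes g :: "nat \<Rightarrow> real"
  assumes "n > 0"
  shows "(MAX i\<in>{..<n}. max (g i) (g (i + n))) = (MAX i\<in>{..<2 * n}. g i)"
proof (rule antisym)
  show "(MAX i\<in>{..<n}. max (g i) (g (i + n))) \<le> (MAX i\<in>{..<2 * n}. g i)"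
    using assms by (intro Max.boundedI) auto
  have "g i \<le> (MAX i\<in>{..<n}. max (g i) (g (i + n)))" if "i < 2 * n" for i
  proof -
    have "max (g (i mod n)) (g (i mod n + n)) \<le> (MAX i\<in>{..<n}. max (g i) (g (i + n)))"
      using assms by (intro Max_ge) auto
    moreover have "i = i mod n \<or> i = i mod n + n"
      using that assms by (cases "i < n") (auto simp: mod_if)
    ultimately show ?thesis by (metis max.bounded_iff)
  qed
  then show "(MAX i\<in>{..<2 * n}. g i) \<le> (MAX i\<in>{..<n}. max (g i) (g (i + n)))"
    using assms by (intro Max.boundedI) (auto simp: lessThan_empty_iff)
qed

text \<open>For nonnegative entries \<open>max u v = u + max 0 (v - u)\<close> costs two ReLU layers. Pairing the
  entries \<open>i\<close> and \<open>i + 2 * 2 ^ k\<close> preserves the parity of the index, so the maxima over the even and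
  over the odd entries are computed by one and the same tournament.\<close>

lemma realizable_tournament:
  assumes H: "H > 0"
  shows "realizable lam H (2 * 2 ^ k + (H - 1)) (2 * k + 1) (2 * 2 ^ k + (H - 1)) (12 * 2 ^ k)
    {y \<in> carrier_vec (2 * 2 ^ k + (H - 1)). \<forall>i<2 * 2 ^ k. 0 \<le> y $ i}
    (\<lambda>y. ((MAX i\<in>{..<2 ^ k}. y $ (2 * i)) - (MAX i\<in>{..<2 ^ k}. y $ (2 * i + 1))) / 2)"
proof (induction k)
  case 0
  \<comment> \<open>One even and one odd entry are left, and the output map takes half their
    difference.\<close>
  define A :: "real mat" where "A = mat 1 (2 + (H - 1))
    (\<lambda>(i, j). if j = 0 then 1 / 2 else if j = 1 then - 1 / 2 else 0)"
  have A: "A \<in> carrier_mat 1 (2 + (H - 1))" by (simp add: A_def)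
  have "nnz_mat A \<le> 1 * 2"
    by (rule nnz_mat_le[OF A, where S = "\<lambda>_. {0, 1}"]) (auto simp: A_def split: if_splits)
  moreover have "(A *\<^sub>v y) $ 0 = (y $ 0 - y $ 1) / 2" if "y \<in> carrier_vec (2 + (H - 1))" for y
    by (subst mult_mat_vec_support[OF A that, where S = "{0, 1}"])
       (auto simp: A_def field_simps)
  ultimately have "realizable lam H (2 + (H - 1)) 1 (2 + (H - 1)) 12
    {y \<in> carrier_vec (2 + (H - 1)). \<forall>i<2. 0 \<le> y $ i} (\<lambda>y. (y $ 0 - y $ 1) / 2)"
    by (intro realizable_mono[OF realizable_linear[OF _ A] order_refl]) auto
  then show ?case by (simp add: lessThan_Suc)
next
  case (Suc k)
  define n :: nat where "n = 2 * 2 ^ k"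
  have n: "n > 0" "2 * 2 ^ Suc k = 2 * n" by (auto simp: n_def)
  let ?e = "H - 1"
  define f where
    "f = (\<lambda>y :: real vec. ((MAX i\<in>{..<2 ^ k}. y $ (2 * i)) - (MAX i\<in>{..<2 ^ k}. y $ (2 * i + 1))) / 2)"
  \<comment> \<open>For a pair \<open>u\<close>, \<open>v\<close> at positions \<open>i\<close> and
    \<open>i + n\<close>, \<open>B\<close> yields \<open>u\<close> and \<open>v - u\<close>; after
    the ReLU, \<open>A\<close> adds the two results. With at most \<open>8 * 2 ^ k\<close> nonzero
    entries in \<open>B\<close> and \<open>4 * 2 ^ k\<close> in \<open>A\<close>, a round costs
    \<open>12 * 2 ^ k\<close>, which exactly doubles the bound for \<open>k\<close>.\<close>
  define A where "A = mat n (2 * n + ?e) (\<lambda>(i, j). if j = i \<or> j = i + n then 1 else 0 :: real)"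
  define B where "B = mat (2 * n) (2 * n + ?e)
    (\<lambda>(i, j). if j = i then 1 else if n \<le> i \<and> j = i - n then - 1 else 0 :: real)"
  have A: "A \<in> carrier_mat n (2 * n + ?e)" and B: "B \<in> carrier_mat (2 * n) (2 * n + ?e)"
    by (auto simp: A_def B_def)
  have nnzA: "nnz_mat A \<le> n * 2"
    by (rule nnz_mat_le[OF A, where S = "\<lambda>i. {i, i + n}"])
       (auto simp: A_def card_insert_if split: if_splits)
  have nnzB: "nnz_mat B \<le> 2 * n * 2"
    \<comment> \<open>For \<open>i < n\<close> truncated subtraction makes \<open>i - n\<close>
      equal to 0; the set still has at most two elements.\<close>
    by (rule nnz_mat_le[OF B, where S = "\<lambda>i. {i, i - n}"])
       (auto simp: B_def card_insert_if split: if_splits)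
  let ?T = "\<lambda>m. {y \<in> carrier_vec (m + ?e). \<forall>i<m. 0 \<le> (y :: real vec) $ i}"
  let ?a = "\<lambda>z. relu (A *\<^sub>v z + 0\<^sub>v n) @\<^sub>v 0\<^sub>v ?e"
  let ?b = "\<lambda>y. relu (B *\<^sub>v y + 0\<^sub>v (2 * n)) @\<^sub>v 0\<^sub>v ?e"
  have 1: "realizable lam H (2 * n + ?e) (Suc (2 * k + 1)) (max (2 * n + ?e) (n + ?e))
      (nnz_mat A + nnz_vec (0\<^sub>v n :: real vec) + 12 * 2 ^ k) (?T (2 * n)) (\<lambda>z. f (?a z))"
    by (rule realizable_prepend[OF Suc.IH[folded n_def f_def] H])
       (use n A in \<open>auto simp: relu_def\<close>)
  have entry: "?a (?b y) $ i = max (y $ i) (y $ (i + n))" if y: "y \<in> ?T (2 * n)" and i: "i < n" for y i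
  proof -
    have yc: "y \<in> carrier_vec (2 * n + ?e)" using y by simp
    have bc: "?b y \<in> carrier_vec (2 * n + ?e)" using B by (rule layer_output_carrier) simp
    have B1: "(B *\<^sub>v y) $ i = y $ i"
      using i by (subst mult_mat_vec_support[OF B yc, where S = "{i}"]) (auto simp: B_def)
    have B2: "(B *\<^sub>v y) $ (i + n) = y $ (i + n) - y $ i"
      using i by (subst mult_mat_vec_support[OF B yc, where S = "{i, i + n}"]) (auto simp: B_def)
    have "?b y $ i = y $ i" "?b y $ (i + n) = max 0 (y $ (i + n) - y $ i)"
      using i y B B1 B2 by (auto simp: relu_def)
    moreover have "(A *\<^sub>v ?b y) $ i = ?b y $ i + ?b y $ (i + n)"
      using i n by (subst mult_mat_vec_support[OF A bc, where S = "{i, i + n}"]) (auto simp: A_def)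
    ultimately have "(A *\<^sub>v ?b y) $ i = max (y $ i) (y $ (i + n))" by simp
    \<comment> \<open>The maximum is at least \<open>y $ i\<close>, hence nonnegative, so the outer
      ReLU leaves it unchanged.\<close>
    moreover have "0 \<le> y $ i" using y i by simp
    moreover have "?a (?b y) $ i = max 0 ((A *\<^sub>v ?b y) $ i)"
      using i A by (simp add: relu_def)
    ultimately show ?thesis by simp
  qed
  have result: "f (?a (?b y)) =
     ((MAX i\<in>{..<2 ^ Suc k}. y $ (2 * i)) - (MAX i\<in>{..<2 ^ Suc k}. y $ (2 * i + 1))) / 2"
    if y: "y \<in> ?T (2 * n)" for y
  proof -
    have "(MAX i\<in>{..<2 ^ k}. ?a (?b y) $ (2 * i)) =
        (MAX i\<in>{..<2 ^ k}. max (y $ (2 * i)) (y $ (2 * (i + 2 ^ k))))"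
      by (intro arg_cong[where f = Max] image_cong refl, subst entry[OF y])
         (auto simp: n_def algebra_simps)
    moreover have "(MAX i\<in>{..<2 ^ k}. ?a (?b y) $ (2 * i + 1)) =
        (MAX i\<in>{..<2 ^ k}. max (y $ (2 * i + 1)) (y $ (2 * (i + 2 ^ k) + 1)))"
      by (intro arg_cong[where f = Max] image_cong refl, subst entry[OF y])
         (auto simp: n_def algebra_simps)
    ultimately show ?thesis
      unfolding f_def
      using Max_halves[of "2 ^ k" "\<lambda>i. y $ (2 * i)"] Max_halves[of "2 ^ k" "\<lambda>i. y $ (2 * i + 1)"]
      by simp
  qed
  have "realizable lam H (2 * n + ?e) (Suc (Suc (2 * k + 1)))
      (max (2 * n + ?e) (max (2 * n + ?e) (n + ?e)))
      (nnz_mat B + nnz_vec (0\<^sub>v (2 * n) :: real vec) +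
        (nnz_mat A + nnz_vec (0\<^sub>v n :: real vec) + 12 * 2 ^ k)) (?T (2 * n))
      (\<lambda>y. ((MAX i\<in>{..<2 ^ Suc k}. y $ (2 * i)) - (MAX i\<in>{..<2 ^ Suc k}. y $ (2 * i + 1))) / 2)"
    by (rule realizable_prepend[OF 1 H _ _ B]) (use n B result in \<open>auto simp: relu_def\<close>)
  then have "realizable lam H (2 * n + ?e) (Suc (Suc (2 * k + 1))) (2 * n + ?e) (12 * 2 ^ Suc k)
      (?T (2 * n))
      (\<lambda>y. ((MAX i\<in>{..<2 ^ Suc k}. y $ (2 * i)) - (MAX i\<in>{..<2 ^ Suc k}. y $ (2 * i + 1))) / 2)"
    by (rule realizable_mono) (use nnzA nnzB in \<open>auto simp: n_def\<close>)
  then show ?case by (simp only: n(2)) simp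
qed

section \<open>The two layers computing the cones\<close>

text \<open>The first hidden layer consists of blocks of length \<open>d\<close>. The weights are
  defined by testing \<open>j div d\<close>; as intervals, the blocks can be summed and
  counted.\<close>

lemma div_eq_iff_mem_block:
  fixes d j m :: nat
  assumes "d > 0"
  shows "j div d = m \<longleftrightarrow> j \<in> {m * d..<m * d + d}"
  using assms dividend_less_div_times[of d j] by (auto simp: algebra_simps intro: div_nat_eqI)

text \<open>Since \<open>\<bar>t - s\<bar> = t - s + 2 * max 0 (s - t)\<close>, the first layer only has to carry \<open>x\<close>
  itself (as block \<open>M\<close>, where \<open>x \<ge> 0\<close> passes through the ReLU) next to one ReLU per coordinate of
  each \<open>b m\<close>. The second layer adds a constant \<open>C\<close> that makes all entries nonnegative on the cube
  and cancels in the difference of the two maxima; its excess rows repeat index \<open>M - 1\<close>.\<close>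

lemma realizable_cone_maxima:
  fixes \<alpha> c :: "nat \<Rightarrow> real" and b :: "nat \<Rightarrow> real vec"
  assumes H: "H > 0" and d: "d > 0" and M: "M > 0" "M \<le> 2 ^ k"
    and b: "\<And>m. m < M \<Longrightarrow> b m \<in> unit_cube d" and c: "\<And>m. m < M \<Longrightarrow> 0 \<le> c m"
  shows "realizable lam H d (2 * k + 3) ((M + 1) * d + 2 * 2 ^ k + H)
    (2 * ((M + 1) * d) + 2 * 2 ^ k * (2 * d + 1) + 12 * 2 ^ k) (unit_cube d)
    (\<lambda>x. ((MAX m\<in>{..<M}. \<alpha> m - c m * l1_norm (x - b m)) -
          (MAX m\<in>{..<M}. - \<alpha> m - c m * l1_norm (x - b m))) / 2)"
proof -
  let ?e = "H - 1"
  define D where "D = (M + 1) * d"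
  define n :: nat where "n = 2 * 2 ^ k"
  \<comment> \<open>Points of the cube have l1-distance at most \<open>d\<close>, and the sum
    dominates each of its terms, so \<open>C\<close> outweighs every value that can occur with a
    minus sign.\<close>
  define C where "C = (\<Sum>m<M. \<bar>\<alpha> m\<bar> + c m * d)"
  \<comment> \<open>Rows \<open>2 * m\<close> and \<open>2 * m + 1\<close> carry the cones with
    \<open>\<alpha> m\<close> and \<open>- \<alpha> m\<close>, matching the even and odd entries of
    the tournament.\<close>
  define ix where "ix r = min (r div 2) (M - 1)" for r
  have ix: "ix r < M" for r using M by (auto simp: ix_def)
  define A where "A = mat D d
    (\<lambda>(r, j). if j = r mod d then if r div d < M then - 1 else 1 else 0 :: real)"
  define p where "p = vec D (\<lambda>r. if r div d < M then b (r div d) $ (r mod d) else 0)"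
  \<comment> \<open>Per coordinate, \<open>- c * \<bar>t - s\<bar>\<close> equals
    \<open>- 2 * c * max 0 (s - t) - c * t + c * s\<close>: the first term reads block
    \<open>ix r\<close>, the second block \<open>M\<close>, and the third is part of the bias
    \<open>q\<close>. On idle coordinates \<open>j div d\<close> exceeds \<open>M\<close>, so their
    weight is 0.\<close>
  define B where "B = mat n (D + ?e) (\<lambda>(r, j). if j div d = ix r then - 2 * c (ix r)
    else if j div d = M then - c (ix r) else 0)"
  define q where "q = vec n (\<lambda>r. C + (if even r then \<alpha> (ix r) else - \<alpha> (ix r))
    + c (ix r) * (\<Sum>i<d. b (ix r) $ i))"
  have A: "A \<in> carrier_mat D d" and p: "p \<in> carrier_vec D"
    and B: "B \<in> carrier_mat n (D + ?e)" and q: "q \<in> carrier_vec n"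
    by (auto simp: A_def p_def B_def q_def)
  let ?z = "\<lambda>x. relu (A *\<^sub>v x + p) @\<^sub>v 0\<^sub>v ?e"
  let ?y = "\<lambda>x. relu (B *\<^sub>v ?z x + q) @\<^sub>v 0\<^sub>v ?e"
  let ?g = "\<lambda>y. ((MAX i\<in>{..<2 ^ k}. y $ (2 * i)) - (MAX i\<in>{..<2 ^ k}. y $ (2 * i + 1))) / 2"
  have posD: "D > 0" and posn: "n > 0" using d by (auto simp: D_def n_def)
  have idx: "m * d + i < D" if "m \<le> M" "i < d" for m i
  proof -
    have "m * d + i < m * d + d" using that by simp
    also have "\<dots> \<le> D" using mult_le_mono1[of "m + 1" "M + 1" d] that by (simp add: D_def)
    finally show ?thesis .
  qed
  have zc: "?z x \<in> carrier_vec (D + ?e)" for x using A p by (rule layer_output_carrier)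
  have z: "?z x $ (m * d + i) = (if m < M then max 0 (b m $ i - x $ i) else x $ i)"
    if x: "x \<in> unit_cube d" and m: "m \<le> M" and i: "i < d" for x m i
  proof -
    have xc: "x \<in> carrier_vec d" and xi: "0 \<le> x $ i" using x i by (auto simp: unit_cube_def)
    have "(A *\<^sub>v x) $ (m * d + i) = (if m < M then - x $ i else x $ i)"
      using i idx[OF m i]
      by (subst mult_mat_vec_support[OF A xc, where S = "{i}"]) (auto simp: A_def)
    then show ?thesis
      using A p m i idx[OF m i] xi by (auto simp: relu_def p_def)
  qed
  have Bz: "(B *\<^sub>v ?z x + q) $ r = C + (if even r then \<alpha> (ix r) else - \<alpha> (ix r))
      - c (ix r) * l1_norm (x - b (ix r))" if x: "x \<in> unit_cube d" and r: "r < n" for x r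
  proof -
    let ?m = "ix r"
    let ?S = "{?m * d..<?m * d + d}" and ?S' = "{M * d..<M * d + d}"
    have le: "?m * d + d \<le> M * d"
      using mult_le_mono1[of "?m + 1" M d] ix[of r] by (simp only: add_mult_distrib) simp
    have sub: "?S \<union> ?S' \<subseteq> {..<D + ?e}"
      using le by (auto simp: D_def)
    have disj: "?S \<inter> ?S' = {}"
      using le by auto
    have entry: "B $$ (r, m * d + i) = (if m = ?m then - 2 * c ?m else - c ?m)"
      if "i < d" "m = ?m \<or> m = M" for m i
      using that r ix[of r] idx[of m i] by (auto simp: B_def)
    have shift: "sum h {m * d..<m * d + d} = (\<Sum>i<d. h (m * d + i))" for m and h :: "nat \<Rightarrow> real"
      using sum.shift_bounds_nat_ivl[of h 0 "m * d" d] by (simp add: atLeast0LessThan add.commute)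
    have "(B *\<^sub>v ?z x) $ r = (\<Sum>j\<in>?S \<union> ?S'. B $$ (r, j) * ?z x $ j)"
      by (rule mult_mat_vec_support[OF B zc r sub]) (use r in \<open>simp add: B_def div_eq_iff_mem_block[OF d] del: atLeastLessThan_iff\<close>)
    also have "\<dots> = (\<Sum>i<d. B $$ (r, ?m * d + i) * ?z x $ (?m * d + i))
        + (\<Sum>i<d. B $$ (r, M * d + i) * ?z x $ (M * d + i))"
      by (subst sum.union_disjoint) (use disj in \<open>auto simp only: shift finite_atLeastLessThan\<close>)
    also have "\<dots> = (\<Sum>i<d. - 2 * c ?m * max 0 (b ?m $ i - x $ i)) + (\<Sum>i<d. - c ?m * x $ i)"
      using ix[of r] by (intro arg_cong2[where f = "(+)"] sum.cong refl)
        (simp_all add: entry z[OF x] del: One_nat_def)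
    also have "\<dots> = (\<Sum>i<d. - c ?m * (\<bar>x $ i - b ?m $ i\<bar> + b ?m $ i))"
      unfolding sum.distrib[symmetric]
      by (intro sum.cong refl) (auto simp: max_def abs_if algebra_simps)
    also have "\<dots> = - c ?m * l1_norm (x - b ?m) - c ?m * (\<Sum>i<d. b ?m $ i)"
      using carrier_vecD[of "b ?m" d] b[OF ix[of r]]
      by (auto simp: l1_norm_def unit_cube_def sum_distrib_left sum.distrib algebra_simps
          sum_negf sum_subtractf)
    finally show ?thesis using r B q by (simp add: q_def)
  qed
  have nonneg: "0 \<le> C + (if even r then \<alpha> (ix r) else - \<alpha> (ix r)) - c (ix r) * l1_norm (x - b (ix r))"
    if x: "x \<in> unit_cube d" for x r
  proof -
    have bx: "b (ix r) \<in> unit_cube d" by (rule b[OF ix])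
    have "l1_norm (x - b (ix r)) = (\<Sum>i<d. \<bar>x $ i - b (ix r) $ i\<bar>)"
      using bx by (auto simp: l1_norm_def unit_cube_def)
    also have "\<dots> \<le> (\<Sum>i<d. 1)"
    proof (rule sum_mono)
      fix i assume "i \<in> {..<d}"
      then have "0 \<le> x $ i" "x $ i \<le> 1" "0 \<le> b (ix r) $ i" "b (ix r) $ i \<le> 1"
        using x bx by (auto simp: unit_cube_def)
      then show "\<bar>x $ i - b (ix r) $ i\<bar> \<le> 1" by linarith
    qed
    finally have "l1_norm (x - b (ix r)) \<le> d" by simp
    then have "c (ix r) * l1_norm (x - b (ix r)) \<le> c (ix r) * d"
      using c[OF ix] by (intro mult_left_mono) auto
    moreover have "\<bar>\<alpha> (ix r)\<bar> + c (ix r) * d \<le> C"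
      unfolding C_def using c ix[of r] by (intro member_le_sum) auto
    ultimately show ?thesis by (auto simp: abs_if split: if_splits)
  qed
  have y: "?y x $ r = C + (if even r then \<alpha> (ix r) else - \<alpha> (ix r)) - c (ix r) * l1_norm (x - b (ix r))"
    if "x \<in> unit_cube d" "r < n" for x r
    using Bz[OF that] nonneg[OF that(1), of r] that B q by (simp add: relu_def)
  \<comment> \<open>As \<open>M \<le> 2 ^ k\<close>, the index \<open>min i (M - 1)\<close> runs
    through all of \<open>{..<M}\<close>, so repeated rows do not affect the maximum.\<close>
  have Max_ix: "(MAX i\<in>{..<2 ^ k}. C + h (min i (M - 1))) = (MAX m\<in>{..<M}. h m) + C"
    for h :: "nat \<Rightarrow> real"
  proof -
    have "(\<lambda>i. min i (M - 1)) ` {..<2 ^ k} = {..<M}"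
    proof (intro equalityI subsetI)
      fix m assume m: "m \<in> {..<M}"
      then have "m = min m (M - 1)" "m \<in> {..<2 ^ k}" using M by auto
      then show "m \<in> (\<lambda>i. min i (M - 1)) ` {..<2 ^ k}" by (rule image_eqI)
    qed (use M in auto)
    moreover have "(\<lambda>i. C + h (min i (M - 1))) ` {..<2 ^ k} =
        (\<lambda>m. h m + C) ` (\<lambda>i. min i (M - 1)) ` {..<2 ^ k}"
      by (simp add: image_image add.commute)
    moreover have "(MAX m\<in>{..<M}. h m + C) = (MAX m\<in>{..<M}. h m) + C"
      using M by (intro Max_add_commute) auto
    ultimately show ?thesis by (simp only:)
  qed
  have result: "?g (?y x) = ((MAX m\<in>{..<M}. \<alpha> m - c m * l1_norm (x - b m)) -
          (MAX m\<in>{..<M}. - \<alpha> m - c m * l1_norm (x - b m))) / 2" if x: "x \<in> unit_cube d" for x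
  proof -
    have "(MAX i\<in>{..<2 ^ k}. ?y x $ (2 * i)) = (MAX i\<in>{..<2 ^ k}.
        C + (\<alpha> (min i (M - 1)) - c (min i (M - 1)) * l1_norm (x - b (min i (M - 1)))))"
      by (intro arg_cong[where f = Max] image_cong refl, subst y[OF x])
         (auto simp: ix_def n_def)
    moreover have "(MAX i\<in>{..<2 ^ k}. ?y x $ (2 * i + 1)) = (MAX i\<in>{..<2 ^ k}.
        C + (- \<alpha> (min i (M - 1)) - c (min i (M - 1)) * l1_norm (x - b (min i (M - 1)))))"
      by (intro arg_cong[where f = Max] image_cong refl, subst y[OF x])
         (auto simp: ix_def n_def)
    ultimately show ?thesis
      by (simp only: Max_ix[of "\<lambda>m. \<alpha> m - c m * l1_norm (x - b m)"]
          Max_ix[of "\<lambda>m. - \<alpha> m - c m * l1_norm (x - b m)"]) simp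
  qed
  have nnzA: "nnz_mat A \<le> D * 1"
    by (rule nnz_mat_le[OF A, where S = "\<lambda>r. {r mod d}"]) (auto simp: A_def split: if_splits)
  have nnzB: "nnz_mat B \<le> n * (2 * d)"
  proof (rule nnz_mat_le[OF B])
    fix r j assume "r < n" "j < D + ?e" "B $$ (r, j) \<noteq> 0"
    then have "j div d = ix r \<or> j div d = M" by (auto simp: B_def split: if_splits)
    then show "j \<in> {ix r * d..<ix r * d + d} \<union> {M * d..<M * d + d}"
      by (simp only: div_eq_iff_mem_block[OF d] Un_iff)
  next
    fix r
    show "finite ({ix r * d..<ix r * d + d} \<union> {M * d..<M * d + d}) \<and>
        card ({ix r * d..<ix r * d + d} \<union> {M * d..<M * d + d}) \<le> 2 * d"
      using card_Un_le[of "{ix r * d..<ix r * d + d}" "{M * d..<M * d + d}"] by simp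
  qed
  have 1: "realizable lam H (D + ?e) (Suc (2 * k + 1)) (max (D + ?e) (n + ?e))
      (nnz_mat B + nnz_vec q + 12 * 2 ^ k) (?z ` unit_cube d) (\<lambda>z. ?g (relu (B *\<^sub>v z + q) @\<^sub>v 0\<^sub>v ?e))"
  proof (rule realizable_prepend[OF realizable_tournament[OF H, of lam k, folded n_def] H _ posn B q])
    show "?z ` unit_cube d \<subseteq> carrier_vec (D + ?e)" using zc by blast
    \<comment> \<open>The ReLU alone gives the nonnegativity that the tournament requires; the shift
      by \<open>C\<close> serves to evaluate the entries without truncation.\<close>
    show "relu (B *\<^sub>v z + q) @\<^sub>v 0\<^sub>v ?e \<in> {y \<in> carrier_vec (n + ?e). \<forall>i<n. 0 \<le> y $ i}" for z
      using layer_output_carrier[OF B q] B q by (auto simp: relu_def simp del: One_nat_def)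
  qed (use posD in auto)
  have "realizable lam H d (Suc (Suc (2 * k + 1))) (max d (max (D + ?e) (n + ?e)))
      (nnz_mat A + nnz_vec p + (nnz_mat B + nnz_vec q + 12 * 2 ^ k)) (unit_cube d)
      (\<lambda>x. ((MAX m\<in>{..<M}. \<alpha> m - c m * l1_norm (x - b m)) -
          (MAX m\<in>{..<M}. - \<alpha> m - c m * l1_norm (x - b m))) / 2)"
    by (rule realizable_prepend[OF 1 H d posD A p])
       (use result in \<open>auto simp: unit_cube_def\<close>)
  moreover have "max d (max (D + ?e) (n + ?e)) \<le> (M + 1) * d + 2 * 2 ^ k + H"
    by (auto simp: D_def n_def)
  moreover have "nnz_mat A + nnz_vec p + (nnz_mat B + nnz_vec q + 12 * 2 ^ k) \<le>
      2 * ((M + 1) * d) + 2 * 2 ^ k * (2 * d + 1) + 12 * 2 ^ k"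
    using nnzA nnzB nnz_vec_le[of p] nnz_vec_le[of q] p q
    by (simp add: D_def n_def algebra_simps)
  ultimately show ?thesis
    using realizable_mono by (simp add: numeral_3_eq_3)
qed

section \<open>Passage to \<open>f_hat\<close> and the constants\<close>

text \<open>Writing the minimum as a negated maximum flips the sign of \<open>aG\<close> but keeps a
  falling cone, so both maxima use the same distance terms.\<close>

lemma f_hat_eq_Max_difference:
  assumes "M > 0"
  shows "f_hat M \<theta> G x =
    ((MAX m\<in>{..<M}. (mat_of_row (vec M (\<lambda>m. fst (\<theta> m))) * G) $$ (0, m)
        - snd (snd (\<theta> m)) * l1_norm (x - fst (snd (\<theta> m)))) -
     (MAX m\<in>{..<M}. - (mat_of_row (vec M (\<lambda>m. fst (\<theta> m))) * G) $$ (0, m)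
        - snd (snd (\<theta> m)) * l1_norm (x - fst (snd (\<theta> m))))) / 2"
proof -
  have "(MIN m\<in>{..<M}. u m) = - (MAX m\<in>{..<M}. - u m)" for u :: "nat \<Rightarrow> real"
    using assms minus_Max_eq_Min[of "(\<lambda>m. - u m) ` {..<M}"] by (simp add: image_image lessThan_empty_iff)
  then show ?thesis by (simp add: f_hat_def Let_def field_simps)
qed

text \<open>Padding to a full binary tournament at most doubles the number of entries, which keeps
  width and parameter count linear in \<open>M\<close>.\<close>

lemma ex_power_of_2_between:
  fixes M :: nat
  assumes "M > 0"
  obtains k :: nat where "M \<le> 2 ^ k" "2 ^ k \<le> 2 * M"
proof -
  obtain n where "2 ^ n \<le> M" "M < 2 ^ (n + 1)"
    using ex_power_ivl1[of 2 M] assms by auto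
  then show ?thesis using that[of "n + 1"] by simp
qed

theorem corollary3p6:
  fixes d :: nat
  assumes "d > 0"
  shows "\<exists>K_depth K_width K_params :: real.
    \<forall>(M::nat)>0. \<forall>G\<in>carrier_mat M M. \<forall>\<theta> :: nat \<Rightarrow> real \<times> real vec \<times> real.
      (\<forall>m<M. \<theta> m \<in> UNIV \<times> unit_cube d \<times> {0..}) \<longrightarrow>
      (\<forall>(lam::real)>0. \<forall>(H::nat)>0. \<exists>N :: transformer.
         transformer_between d 1 N \<and> n_headed H N \<and>
         real (depth N) \<le> K_depth * max 1 (ln (real M)) \<and>
         real (width N) \<le> K_width * max 1 (real (M + H)) \<and>
         real (nonzero_params N) \<le> K_params * max 1 (real M) \<and>
         (\<forall>x\<in>unit_cube d. transformer_fun lam N x = f_hat M \<theta> G x))"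
proof (rule exI[of _ 9], rule exI[of _ "2 * real d + 4"], rule exI[of _ "12 * real d + 28"],
    intro allI impI ballI)
  fix M :: nat and G :: "real mat" and \<theta> :: "nat \<Rightarrow> real \<times> real vec \<times> real" and lam :: real and H :: nat
  assume M: "0 < M" and \<theta>: "\<forall>m<M. \<theta> m \<in> UNIV \<times> unit_cube d \<times> {0..}" and H: "0 < H"
  obtain k where k: "M \<le> 2 ^ k" "2 ^ k \<le> 2 * M" using ex_power_of_2_between[OF M] .
  have "fst (snd (\<theta> m)) \<in> unit_cube d \<and> 0 \<le> snd (snd (\<theta> m))" if "m < M" for m
    using \<theta> that by (auto simp: mem_Times_iff)
  then obtain N where N: "transformer_between d 1 N" "n_headed H N" "depth N = 2 * k + 3"
      "width N \<le> (M + 1) * d + 2 * 2 ^ k + H"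
      "nonzero_params N \<le> 2 * ((M + 1) * d) + 2 * 2 ^ k * (2 * d + 1) + 12 * 2 ^ k"
      "\<forall>x\<in>unit_cube d. transformer_fun lam N x = f_hat M \<theta> G x"
    using realizable_cone_maxima[OF H assms M k(1), of "\<lambda>m. fst (snd (\<theta> m))" "\<lambda>m. snd (snd (\<theta> m))"
        lam "\<lambda>m. (mat_of_row (vec M (\<lambda>m. fst (\<theta> m))) * G) $$ (0, m)"]
    unfolding realizable_def f_hat_eq_Max_difference[OF M] by blast
  have "real k * ln 2 = ln (real (2 ^ k))" by (simp add: ln_realpow)
  also have "\<dots> \<le> ln (real (2 * M))"
    using k(2) M by (subst ln_le_cancel_iff) (auto simp del: of_nat_power of_nat_mult)
  also have "\<dots> = ln 2 + ln (real M)" using M by (simp add: ln_mult)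
  finally have "(real k - 1) * ln 2 \<le> ln (real M)" by (simp add: algebra_simps)
  \<comment> \<open>This uses \<open>ln 2 \<ge> 1 / 2\<close>, multiplied by \<open>k - 1\<close>;
    the case \<open>k = 0\<close> is separate because that factor is negative there.\<close>
  moreover have "real k - 1 \<le> 2 * ((real k - 1) * ln 2) \<or> k = 0"
  proof (cases "k = 0")
    case False
    then have "(real k - 1) * (1 / 2) \<le> (real k - 1) * ln 2"
      using exp_half_le2 by (intro mult_left_mono) (auto simp: ln_ge_iff simp del: divide_le_eq_numeral1 le_divide_eq_numeral1)
    then show ?thesis by simp
  qed simp
  \<comment> \<open>For \<open>k > 0\<close>, \<open>k - 1 \<le> 2 * ln M\<close> gives
    \<open>2 * k + 3 \<le> 5 + 4 * ln M\<close>, whence the constant 9; for \<open>k = 0\<close> the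
    depth is 3.\<close>
  ultimately have depth: "real (depth N) \<le> 9 * max 1 (ln (real M))"
    using N(3) by auto
  have pow: "2 * 2 ^ k \<le> 4 * M" using k(2) by simp
  have Md: "(M + 1) * d \<le> 2 * d * M" using M by (cases M) auto
  have "width N \<le> 2 * d * M + 4 * M + H" using N(4) pow Md by linarith
  also have "\<dots> \<le> (2 * d + 4) * (M + H)" by (simp add: algebra_simps)
  finally have "real (width N) \<le> real ((2 * d + 4) * (M + H))" by (simp only: of_nat_le_iff)
  then have width: "real (width N) \<le> (2 * real d + 4) * max 1 (real (M + H))"
    using M by (simp add: max_def)
  \<comment> \<open>The three parts contribute \<open>4 * d\<close>, \<open>8 * d + 4\<close> and
    \<open>24\<close> per unit of \<open>M\<close>, in total \<open>12 * d + 28\<close>.\<close>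
  have "2 * 2 ^ k * (2 * d + 1) \<le> 4 * M * (2 * d + 1)" using pow by (rule mult_le_mono1)
  then have "nonzero_params N \<le> 2 * (2 * d * M) + 4 * M * (2 * d + 1) + 24 * M"
    using N(5) pow Md by linarith
  also have "\<dots> = (12 * d + 28) * M" by (simp add: algebra_simps)
  finally have "real (nonzero_params N) \<le> real ((12 * d + 28) * M)" by (simp only: of_nat_le_iff)
  then have params: "real (nonzero_params N) \<le> (12 * real d + 28) * max 1 (real M)"
    using M by (simp add: max_def)
  show "\<exists>N. transformer_between d 1 N \<and> n_headed H N \<and>
      real (depth N) \<le> 9 * max 1 (ln (real M)) \<and>
      real (width N) \<le> (2 * real d + 4) * max 1 (real (M + H)) \<and>
      real (nonzero_params N) \<le> (12 * real d + 28) * max 1 (real M) \<and>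
      (\<forall>x\<in>unit_cube d. transformer_fun lam N x = f_hat M \<theta> G x)"
    using N depth width params by blast
qed

end
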